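(* Let $p,q\in\mathbb{N}_0$, let $a_1,\dots,a_p,b_1,\dots,b_q$ be complex numbers with no $b_s$ equal to zero or a negative integer, let $k\in\mathbb{N}$ and $m\in\mathbb{N}_0$. For $n\in\mathbb{N}_0$ let $$A_n^{(k)}(m,x)=x^n\sum_{i=0}^{\lfloor n/k\rfloor}\frac{\prod_{r=1}^p (a_r)^{(i)}}{\prod_{s=1}^q (b_s)^{(i)}}\prod_{j=1}^k\left(-\frac{n-j+1}{k}\right)^{(i)}\frac{m^i}{i!\,x^{ki}},$$ which is a polynomial in $x$ (this is $x^n\,{}_{k+p}F_q\big[a_1,\dots,a_p,-\tfrac{n}{k},-\tfrac{n-1}{k},\dots,-\tfrac{n-k+1}{k};\,b_1,\dots,b_q\,\big|\,\tfrac{m}{x^k}\big]$). Then the sequence $\{A_n^{(k)}(m,x)\}_{n\ge 0}$ is an Appell-type polynomial sequence, i.e. there is a formal power series $A(t)=\sum_{j\ge0}\alpha_j t^j/j!$ with $\alpha_0\neq 0$ such that $$A(t)e^{xt}=\sum_{n=0}^{\infty}A_n^{(k)}(m,x)\frac{t^n}{n!}.$$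
   Context: $x^{(n)}$ denotes the rising factorial (Pochhammer symbol): $x^{(0)}=1$, $x^{(n)}=x(x+1)\cdots(x+n-1)$ for $n\ge1$. An empty product equals $1$. The generalized hypergeometric function is ${}_pF_q[a_1,\dots,a_p;b_1,\dots,b_q\,|\,z]=\sum_{i\ge0}\frac{\prod_r a_r^{(i)}}{\prod_s b_s^{(i)}}\frac{z^i}{i!}$. A polynomial sequence $\{A_n(x)\}$ is called of Appell type if its exponential generating function has the form $A(t)e^{xt}$ for a formal power series $A(t)$ with nonzero constant term (equivalently $\deg A_n=n$ and $A_n'(x)=nA_{n-1}(x)$). *)

theory Defs
  imports "HOL-Analysis.Analysis"
begin

definition hyp_numer_params :: "nat \<Rightarrow> nat \<Rightarrow> complex list" where
  "hyp_numer_params k n = map (\<lambda>j. - ((of_nat n - of_nat j + 1) / of_nat k)) [1..<k+1]"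

text \<open>The numbers of parameters \<open>p\<close> and \<open>q\<close> are the lengths of the lists \<open>as\<close> and \<open>bs\<close>.
  The expression has its intended meaning only for \<open>x \<noteq> 0\<close>, because of the division by \<open>x ^ (k * i)\<close>.\<close>

definition hyp_appell :: "complex list \<Rightarrow> complex list \<Rightarrow> nat \<Rightarrow> nat \<Rightarrow> nat \<Rightarrow> complex \<Rightarrow> complex" where
  "hyp_appell as bs k m n x =
     x ^ n * (\<Sum>i=0..n div k.
       (\<Prod>a\<leftarrow>as. pochhammer a i) / (\<Prod>b\<leftarrow>bs. pochhammer b i)
       * (\<Prod>j=1..k. pochhammer (- ((of_nat n - of_nat j + 1) / of_nat k)) i)
       * (of_nat m ^ i / (fact i * x ^ (k * i))))"

text \<open>The identity of formal power series in \<open>t\<close> is required at every complex value of \<open>x\<close>, with a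
  single series \<open>A\<close> independent of \<open>x\<close>; as the coefficients of \<open>t\<close> on both sides are polynomials in
  \<open>x\<close>, this is the identity over the polynomial ring.\<close>

definition appell_type :: "(nat \<Rightarrow> complex poly) \<Rightarrow> bool" where
  "appell_type P \<longleftrightarrow>
     (\<exists>A :: complex fps. fps_nth A 0 \<noteq> 0 \<and>
        (\<forall>x. A * fps_exp x = Abs_fps (\<lambda>n. poly (P n) x / fact n)))"

end

theory Submission
  imports Defs
begin

text \<open>By the multiplication formula for Pochhammer symbols, the \<open>i\<close>-th rising factorials of the
  \<open>k\<close> numbers \<open>-(n - j + 1)/k\<close> multiply to \<open>(-1/k)^(k i) n!/(n - k i)!\<close> for \<open>k i \<le> n\<close>. Hence the coefficient of
  \<open>x^(n - k i)\<close> in the \<open>n\<close>-th polynomial is \<open>n!/(n - k i)!\<close> times a number \<open>\<alpha>\<^sub>i\<close> independent of \<open>n\<close>,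
  and the generating function is the Cauchy product of \<open>\<Sum>\<^sub>i \<alpha>\<^sub>i t^(k i)\<close> and \<open>e^(x t)\<close>.\<close>

text \<open>Raising \<open>i\<close> by one appends \<open>k\<close> consecutive factors
  \<open>z + k * i + j\<close> with \<open>j < k\<close>. Each is \<open>k\<close> times
  \<open>(z + j) / k + i\<close>, the new last factor of the rising factorial of
  \<open>(z + j) / k\<close>.\<close>

lemma pochhammer_multiplication:
  fixes z :: "'a::field_char_0"
  assumes "k > 0"
  shows "pochhammer z (k * i) = of_nat k ^ (k * i) * (\<Prod>j<k. pochhammer ((z + of_nat j) / of_nat k) i)"
proof (induction i)
  case 0
  show ?case by simp
next
  case (Suc i)
  have k: "of_nat k \<noteq> (0::'a)"
    using assms by simp
  have "pochhammer (z + of_nat (k * i)) k = (\<Prod>j<k. of_nat k * ((z + of_nat j) / of_nat k + of_nat i))"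
    unfolding pochhammer_prod lessThan_atLeast0
    using k by (intro prod.cong) (auto simp: field_simps)
  also have "\<dots> = of_nat k ^ k * (\<Prod>j<k. (z + of_nat j) / of_nat k + of_nat i)"
    by (subst prod.distrib) simp
  finally have step: "pochhammer (z + of_nat (k * i)) k = \<dots>" .
  have "pochhammer z (k * Suc i) = pochhammer z (k * i) * pochhammer (z + of_nat (k * i)) k"
    using pochhammer_product'[of z "k * i" k] by (simp add: add.commute)
  then show ?case
    unfolding Suc.IH step
    by (simp only: pochhammer_Suc prod.distrib mult_Suc_right power_add) (simp only: mult_ac)
qed

text \<open>Up to the sign \<open>(- 1) ^ i\<close> this is a falling factorial of \<open>n\<close>;
  once \<open>i\<close> exceeds \<open>n\<close>, the factor 0 occurs.\<close>

lemma pochhammer_minus_of_nat: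
  "pochhammer (- of_nat n :: 'a::field_char_0) i = (if i \<le> n then (- 1) ^ i * fact n / fact (n - i) else 0)"
proof (cases "i \<le> n")
  case True
  have "(of_nat (n choose i) :: 'a) = (- 1) ^ i * pochhammer (- of_nat n) i / fact i"
    by (simp add: binomial_gbinomial gbinomial_pochhammer)
  then have "(- 1) ^ i * pochhammer (- of_nat n) i = (fact n / fact (n - i) :: 'a)"
    using True by (simp add: binomial_fact field_simps)
  \<comment> \<open>The sign is its own inverse, so a second factor \<open>(- 1) ^ i\<close> moves
    it to the right-hand side.\<close>
  then have "(- 1) ^ i * ((- 1) ^ i * pochhammer (- of_nat n) i) = (- 1) ^ i * (fact n / fact (n - i) :: 'a)"
    by simp
  then show ?thesis
    using True by (simp flip: mult.assoc power_mult_distrib)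
qed (auto simp: pochhammer_of_nat_eq_0_lemma)

lemma prod_pochhammer_numer_params:
  assumes "k \<ge> 1"
  shows "(\<Prod>j=1..k. pochhammer (- ((of_nat n - of_nat j + 1) / of_nat k) :: complex) i) =
    (if k * i \<le> n then (- 1 / of_nat k) ^ (k * i) * fact n / fact (n - k * i) else 0)"
proof -
  \<comment> \<open>Shifting \<open>j\<close> by one brings the parameters into the form of the
    multiplication formula at \<open>z = - n\<close>.\<close>
  have "(\<Prod>j=1..k. pochhammer (- ((of_nat n - of_nat j + 1) / of_nat k) :: complex) i) =
      (\<Prod>j<k. pochhammer ((- of_nat n + of_nat j) / of_nat k) i)"
    by (rule prod.reindex_bij_witness[of _ Suc "\<lambda>j. j - 1"])
       (auto simp: of_nat_diff field_simps minus_divide_left simp del: minus_divide_left [symmetric])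
  also have "\<dots> = pochhammer (- of_nat n) (k * i) / of_nat k ^ (k * i)"
    using assms pochhammer_multiplication[of k "- of_nat n :: complex" i] by simp
  finally show ?thesis
    by (simp add: pochhammer_minus_of_nat power_divide del: divide_minus_left)
qed

text \<open>The coefficients of \<open>fps_hypergeo\<close> are given by \<open>foldl\<close>; this
  turns them into list products.\<close>

lemma foldl_mult_eq_prod_list:
  fixes f :: "'b \<Rightarrow> 'a::comm_monoid_mult"
  shows "foldl (\<lambda>r a. r * f a) c xs = c * (\<Prod>a\<leftarrow>xs. f a)"
  by (induction xs arbitrary: c) (simp_all add: mult.assoc)

lemma prod_list_hyp_numer_params:
  "(\<Prod>a\<leftarrow>hyp_numer_params k n. f a) = (\<Prod>j=1..k. f (- ((of_nat n - of_nat j + 1) / of_nat k)))"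
  unfolding hyp_numer_params_def
  by (simp add: o_def prod.distinct_set_conv_list[symmetric] atLeastLessThanSuc_atLeastAtMost del: upt_Suc)

lemma hyp_appell_eq_eval_fps:
  assumes "k \<ge> 1"
  shows "hyp_appell as bs k m n x =
    x ^ n * eval_fps (fps_hypergeo (as @ hyp_numer_params k n) bs 1) (of_nat m / x ^ k)"
proof -
  let ?F = "fps_hypergeo (as @ hyp_numer_params k n) bs 1"
  have coeff: "fps_nth ?F i = (\<Prod>a\<leftarrow>as. pochhammer a i) *
      (\<Prod>j=1..k. pochhammer (- ((of_nat n - of_nat j + 1) / of_nat k)) i) /
      ((\<Prod>b\<leftarrow>bs. pochhammer b i) * fact i)" for i
    by (simp only: fps_hypergeo_nth foldl_mult_eq_prod_list map_append prod_list.append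
        prod_list_hyp_numer_params power_one mult_1_left mult_1_right of_nat_fact)
  \<comment> \<open>The numerator vanishes for \<open>k * i > n\<close>, so the series terminates
    and convergence is no issue.\<close>
  have zero: "fps_nth ?F i = 0" if "i \<notin> {0..n div k}" for i
    using that assms unfolding coeff prod_pochhammer_numer_params[OF assms]
    by (auto simp: less_eq_div_iff_mult_less_eq mult.commute)
  have "eval_fps ?F (of_nat m / x ^ k) = (\<Sum>i=0..n div k. fps_nth ?F i * (of_nat m / x ^ k) ^ i)"
    unfolding eval_fps_def by (rule suminf_finite) (use zero in \<open>simp_all del: fps_hypergeo_nth\<close>)
  then show ?thesis
    unfolding hyp_appell_def coeff by (simp add: power_divide mult_ac flip: power_mult)
qed

text \<open>Since \<open>k * i \<le> n\<close> throughout the sum, cancelling powers of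
  \<open>x\<close> leaves genuine monomials. The resulting polynomials also have the right value at
  0, where the identity of series is required as well.\<close>

lemma hyp_appell_appell_type:
  assumes "k \<ge> 1"
  shows "\<exists>P. (\<forall>n x. x \<noteq> 0 \<longrightarrow> poly (P n) x = hyp_appell as bs k m n x) \<and> appell_type P"
proof (intro exI conjI allI impI)
  define \<alpha> :: "nat \<Rightarrow> complex" where "\<alpha> = (\<lambda>i. (\<Prod>a\<leftarrow>as. pochhammer a i) / (\<Prod>b\<leftarrow>bs. pochhammer b i) *
      of_nat m ^ i / fact i * (- 1 / of_nat k) ^ (k * i))"
  let ?A = "Abs_fps (\<lambda>N. if k dvd N then \<alpha> (N div k) else 0)"
  let ?P = "\<lambda>n. \<Sum>i=0..n div k. monom (\<alpha> i * fact n / fact (n - k * i)) (n - k * i)"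
  have le: "k * i \<le> n" if "i \<in> {0..n div k}" for i n
    using that assms by (auto simp: less_eq_div_iff_mult_less_eq mult.commute)
  show "poly (?P n) x = hyp_appell as bs k m n x" if "x \<noteq> 0" for n x
    unfolding hyp_appell_def poly_sum poly_monom sum_distrib_left
      prod_pochhammer_numer_params[OF assms] \<alpha>_def
    using le that by (intro sum.cong) (auto simp: power_diff mult_ac)
  have gf: "?A * fps_exp x = Abs_fps (\<lambda>n. poly (?P n) x / fact n)" for x
  proof (rule fps_ext)
    fix n
    have "fps_nth (?A * fps_exp x) n = (\<Sum>N=0..n. fps_nth ?A N * (x ^ (n - N) / fact (n - N)))"
      by (simp add: fps_mult_nth)
    \<comment> \<open>Only multiples of \<open>k\<close> contribute to the convolution; they are
      then reindexed by \<open>N = k * i\<close>.\<close>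
    also have "\<dots> = (\<Sum>N \<in> (*) k ` {0..n div k}. fps_nth ?A N * (x ^ (n - N) / fact (n - N)))"
    proof (rule sum.mono_neutral_right)
      show "(*) k ` {0..n div k} \<subseteq> {0..n}"
        using le by auto
      show "\<forall>N\<in>{0..n} - (*) k ` {0..n div k}. fps_nth ?A N * (x ^ (n - N) / fact (n - N)) = 0"
      proof
        fix N
        assume N: "N \<in> {0..n} - (*) k ` {0..n div k}"
        have "\<not> k dvd N"
        proof
          assume "k dvd N"
          then have "N = k * (N div k)"
            by simp
          moreover have "N div k \<in> {0..n div k}"
            using N by (simp add: div_le_mono)
          ultimately show False
            using N by blast
        qed
        then show "fps_nth ?A N * (x ^ (n - N) / fact (n - N)) = 0"
          by simp
      qed
    qed simp
    also have "\<dots> = (\<Sum>i=0..n div k. \<alpha> i * (x ^ (n - k * i) / fact (n - k * i)))"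
      using assms by (subst sum.reindex) (auto simp: inj_on_def)
    also have "\<dots> = fps_nth (Abs_fps (\<lambda>n. poly (?P n) x / fact n)) n"
      by (simp add: poly_sum poly_monom sum_divide_distrib)
    finally show "fps_nth (?A * fps_exp x) n = \<dots>" .
  qed
  \<comment> \<open>At \<open>i = 0\<close> every rising factorial and power is 1, so the constant
    term \<open>\<alpha> 0\<close> is 1.\<close>
  have "fps_nth ?A 0 \<noteq> 0"
    by (simp add: \<alpha>_def map_replicate_const)
  then show "appell_type ?P"
    unfolding appell_type_def using gf by blast
qed

theorem theorem1:
  fixes as bs :: "complex list" and k m :: nat
  assumes "\<forall>b\<in>set bs. b \<notin> \<int>\<^sub>\<le>\<^sub>0"
    and "k \<ge> 1"
  shows "\<exists>P :: nat \<Rightarrow> complex poly.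
           (\<forall>n x. x \<noteq> 0 \<longrightarrow> poly (P n) x = hyp_appell as bs k m n x) \<and>
           (\<forall>n x. x \<noteq> 0 \<longrightarrow> hyp_appell as bs k m n x =
              x ^ n * eval_fps (fps_hypergeo (as @ hyp_numer_params k n) bs 1) (of_nat m / x ^ k)) \<and>
           appell_type P"
  using hyp_appell_appell_type[OF assms(2), of as bs m] hyp_appell_eq_eval_fps[OF assms(2), of as bs m]
  by blast

end
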